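(* Let $k\ge 0$ be an integer and let $S_k=\{1,2,\ldots,k\}$ (with $S_0=\emptyset$). For every integer $n\ge k+1$, $$rd^{S_k}(n)=F_{n-k}.$$
   Context: A partition is a finite, nonempty, nonincreasing sequence of positive integers called its parts. The perimeter of a partition $\pi$ is $\alpha_\pi+\lambda_\pi-1$, where $\alpha_\pi$ is the largest part of $\pi$ and $\lambda_\pi$ is the number of parts of $\pi$. For a set $S$ of positive integers, $rd^S(n)$ is the number of partitions of perimeter $n$ into distinct parts, none of which lies in $S$. $F_n$ is the $n$th Fibonacci number: $F_0=0$, $F_1=1$, and $F_{n+2}=F_{n+1}+F_n$ for all $n\ge 0$. *)

theory Defs
  imports "HOL-Number_Theory.Fib"
begin

definition is_partition :: "nat list \<Rightarrow> bool" where
  "is_partition p \<longleftrightarrow> p \<noteq> [] \<and> sorted_wrt (\<ge>) p \<and> (\<forall>x\<in>set p. 0 < x)"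

definition perimeter :: "nat list \<Rightarrow> nat" where
  "perimeter p = Max (set p) + length p - 1"

definition rd_partitions :: "nat set \<Rightarrow> nat \<Rightarrow> nat list set" where
  "rd_partitions S n =
     {p. is_partition p \<and> distinct p \<and> set p \<inter> S = {} \<and> perimeter p = n}"

definition rd :: "nat set \<Rightarrow> nat \<Rightarrow> nat" where
  "rd S n = card (rd_partitions S n)"

(* The cardinality in rd is never the junk value 0 of an infinite set. *)
lemma finite_rd_partitions: "finite (rd_partitions S n)"
proof (rule finite_subset)
  show "rd_partitions S n \<subseteq> {p. set p \<subseteq> {..n} \<and> length p \<le> n}"
  proof
    fix p assume p: "p \<in> rd_partitions S n"
    then have ne: "p \<noteq> []" and pos: "\<forall>x\<in>set p. 0 < x"
      and per: "Max (set p) + length p - 1 = n"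
      by (auto simp: rd_partitions_def is_partition_def perimeter_def)
    have "Max (set p) \<in> set p" using ne by simp
    then have "0 < Max (set p)" using pos by blast
    moreover have "0 < length p" using ne by simp
    ultimately have "Max (set p) \<le> n" "length p \<le> n" using per by linarith+
    moreover have "x \<le> n" if "x \<in> set p" for x
      using that \<open>Max (set p) \<le> n\<close> by (meson List.finite_set Max_ge le_trans)
    ultimately show "p \<in> {p. set p \<subseteq> {..n} \<and> length p \<le> n}" by auto
  qed
  show "finite {p. set p \<subseteq> {..n} \<and> length p \<le> n}"
    by (rule finite_lists_length_le) simp
qed

end

theory Submission
  imports Defs
begin

text \<open>
  Strictly decreasing lists with all entries above \<open>k\<close> satisfy the Fibonacci recurrence when
  counted by perimeter. The bijection looks at the largest part \<open>a\<close> of such a partition: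
  if \<open>a - 1\<close> is also a part, deleting \<open>a\<close> lowers the largest part and the number of parts by one
  each, so the perimeter drops by two; if \<open>a - 1\<close> is not a part and \<open>a > k + 1\<close>, replacing \<open>a\<close>
  by \<open>a - 1\<close> lowers the perimeter by one. Both operations are reversible, and the only partition
  to which neither applies is the single part \<open>k + 1\<close>, of perimeter \<open>k + 1\<close>
  (\<open>rd_partitions_rec\<close>). Since no partition has perimeter \<open>k\<close> and exactly one has perimeter
  \<open>k + 1\<close>, the count at perimeter \<open>k + m\<close> is the Fibonacci number with index \<open>m\<close>.
\<close>

text \<open>The excluded set \<open>{1..k}\<close> is to keep one syntactic form under simplification.\<close>

declare One_nat_def [simp del]

lemma sorted_wrt_ge_distinct_iff:
  fixes p :: "'a::linorder list"
  shows "sorted_wrt (\<ge>) p \<and> distinct p \<longleftrightarrow> sorted_wrt (>) p"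
  by (induction p) (auto simp: less_le)

text \<open>In a decreasing list the maximum is the head, so the perimeter can be read off by pattern
  matching; this turns the operations of the recurrence into operations on list constructors.\<close>

lemma Cons_in_rd_partitions_iff:
  "a # q \<in> rd_partitions {1..k} n \<longleftrightarrow>
     sorted_wrt (>) q \<and> (\<forall>x\<in>set q. k < x \<and> x < a) \<and> k < a \<and> a + length q = n"
proof -
  have "Max (set (a # q)) = a" if "sorted_wrt (>) (a # q)"
    using that by (intro Max_eqI) auto
  then show ?thesis
    using sorted_wrt_ge_distinct_iff[of "a # q"]
    unfolding rd_partitions_def is_partition_def perimeter_def
    by (auto simp: disjoint_iff not_le Suc_le_eq)
qed

lemma Nil_notin_rd_partitions: "[] \<notin> rd_partitions S n"
  by (simp add: rd_partitions_def is_partition_def)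

fun raise_head :: "nat list \<Rightarrow> nat list" where
  "raise_head [] = []"
| "raise_head (a # q) = Suc a # q"

fun push_Suc_head :: "nat list \<Rightarrow> nat list" where
  "push_Suc_head [] = []"
| "push_Suc_head (a # q) = Suc a # a # q"

lemma inj_on_raise_head: "inj_on raise_head (rd_partitions S n)"
proof (rule inj_onI)
  fix p r assume "p \<in> rd_partitions S n" "r \<in> rd_partitions S n" "raise_head p = raise_head r"
  then show "p = r"
    by (cases p; cases r) (auto simp: Nil_notin_rd_partitions)
qed

lemma inj_on_push_Suc_head: "inj_on push_Suc_head (rd_partitions S n)"
proof (rule inj_onI)
  fix p r assume "p \<in> rd_partitions S n" "r \<in> rd_partitions S n"
    "push_Suc_head p = push_Suc_head r"
  then show "p = r"
    by (cases p; cases r) (auto simp: Nil_notin_rd_partitions)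
qed

text \<open>The bound \<open>k \<le> n\<close> keeps out the perimeter \<open>k + 1\<close> of the partition into the single
  part \<open>k + 1\<close>, which arises from no smaller one.\<close>

lemma rd_partitions_rec:
  assumes "k \<le> n"
  shows "rd_partitions {1..k} (Suc (Suc n)) =
    raise_head ` rd_partitions {1..k} (Suc n) \<union> push_Suc_head ` rd_partitions {1..k} n"
    (is "?L = ?R \<union> ?P")
proof
  show "?L \<subseteq> ?R \<union> ?P"
  proof
    fix p assume p: "p \<in> ?L"
    then obtain b q where b: "p = b # q"
      by (cases p) (auto simp: Nil_notin_rd_partitions)
    with p obtain a where a: "b = Suc a"
      by (cases b) (auto simp: Cons_in_rd_partitions_iff)
    show "p \<in> ?R \<union> ?P"
    proof (cases "a \<in> set q")
      case True
      \<comment> \<open>every part after the first is at most \<open>a\<close>, so \<open>a\<close> can only be the second part\<close>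
      with p obtain r where "q = a # r"
        by (cases q) (force simp: a b Cons_in_rd_partitions_iff)+
      with p have "a # r \<in> rd_partitions {1..k} n"
        by (auto simp: a b Cons_in_rd_partitions_iff)
      then have "push_Suc_head (a # r) \<in> ?P" by (rule imageI)
      then show ?thesis by (simp add: a b \<open>q = a # r\<close>)
    next
      case False
      have less: "\<forall>x\<in>set q. k < x \<and> x < a"
        using p False by (auto simp: a b Cons_in_rd_partitions_iff less_Suc_eq)
      moreover have "k < a"
        using p less assms by (cases q) (auto simp: a b Cons_in_rd_partitions_iff)
      ultimately have "a # q \<in> rd_partitions {1..k} (Suc n)"
        using p by (auto simp: a b Cons_in_rd_partitions_iff)
      then have "raise_head (a # q) \<in> ?R" by (rule imageI)
      then show ?thesis by (simp add: a b)
    qed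
  qed
next
  have "raise_head p \<in> ?L" if "p \<in> rd_partitions {1..k} (Suc n)" for p
    using that by (cases p) (auto simp: Nil_notin_rd_partitions Cons_in_rd_partitions_iff)
  moreover have "push_Suc_head p \<in> ?L" if "p \<in> rd_partitions {1..k} n" for p
    using that by (cases p) (auto simp: Nil_notin_rd_partitions Cons_in_rd_partitions_iff)
  ultimately show "?R \<union> ?P \<subseteq> ?L" by blast
qed

text \<open>The two images are told apart by whether the largest part and the next one are consecutive.\<close>

lemma raise_head_push_Suc_head_disjoint:
  "raise_head ` rd_partitions {1..k} m \<inter> push_Suc_head ` rd_partitions {1..k} n = {}"
proof -
  have "raise_head p \<noteq> push_Suc_head r"
    if "p \<in> rd_partitions {1..k} m" "r \<in> rd_partitions {1..k} n" for p r
    using that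
    by (cases p; cases r) (auto simp: Nil_notin_rd_partitions Cons_in_rd_partitions_iff)
  then show ?thesis by blast
qed

lemma rd_rec:
  assumes "k \<le> n"
  shows "rd {1..k} (Suc (Suc n)) = rd {1..k} (Suc n) + rd {1..k} n"
  unfolding rd_def rd_partitions_rec[OF assms]
  by (simp add: card_Un_disjoint finite_rd_partitions raise_head_push_Suc_head_disjoint
      card_image inj_on_raise_head inj_on_push_Suc_head)

lemma rd_partitions_at_k: "rd_partitions {1..k} k = {}"
proof -
  have "p \<notin> rd_partitions {1..k} k" for p
    by (cases p) (auto simp: Nil_notin_rd_partitions Cons_in_rd_partitions_iff)
  then show ?thesis by blast
qed

lemma rd_partitions_at_Suc_k: "rd_partitions {1..k} (Suc k) = {[Suc k]}"
proof -
  have "p \<in> rd_partitions {1..k} (Suc k) \<longleftrightarrow> p = [Suc k]" for p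
    by (cases p) (auto simp: Nil_notin_rd_partitions Cons_in_rd_partitions_iff
        simp flip: length_0_conv)
  then show ?thesis by blast
qed

text \<open>Starting at perimeter \<open>k\<close>, where the count is \<open>0\<close>, aligns the initial values with those
  of the Fibonacci numbers.\<close>

lemma rd_eq_fib: "rd {1..k} (k + m) = fib m"
proof (induction m rule: fib.induct)
  case 1
  then show ?case by (simp add: rd_def rd_partitions_at_k)
next
  case 2
  then show ?case by (simp add: rd_def rd_partitions_at_Suc_k)
next
  case (3 m)
  then show ?case using rd_rec[of k "k + m"] by simp
qed

theorem mainTheorem8:
  fixes k n :: nat
  assumes "n \<ge> k + 1"
  shows "rd {1..k} n = fib (n - k)"
  using rd_eq_fib[of k "n - k"] assms by simp

end
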